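(* Let $d\ge 1$ and let $\{S_m\}_{m\ge 0}$ be any random walk on $\mathbb{Z}^d$ started at $0$. Let $L_n$ be the number of inner boundary points of the range $\{S_m\}_{m=0}^{n}$. Then $$\lim_{n\to\infty}\frac{L_n}{n}=q\quad\text{almost surely},$$ where $$q=P\Big(\{S_m\}_{m=0}^{\infty}\cup\{S'_m\}_{m=0}^{\infty}\not\supset\mathcal{N}(0)\ \text{ and }\ 0\notin\{S_m\}_{m=1}^{\infty}\Big),$$ and $\{S'_m\}_{m\ge0}$ is a dual walk of $\{S_m\}_{m\ge 0}$ independent of it.
   Context: Random walk: $X_1,X_2,\dots$ are i.i.d. $\mathbb{Z}^d$-valued random variables (with an arbitrary common law), $S_0=0$ and $S_k=\sum_{i=1}^k X_i$; $P$ denotes the underlying probability law. For $a\in\mathbb{Z}^d$, $\mathcal{N}(a)=\{z\in\mathbb{Z}^d:\mathrm{dist}(a,z)=1\}$ is the set of the $2d$ nearest neighbors of $a$ in the lattice $\mathbb{Z}^d$ ($\mathrm{dist}$ is Euclidean distance). The inner boundary of the range $\{S_m\}_{m=0}^n$ is the set of points $H_n=\{S_i:0\le i\le n,\ \{S_m\}_{m=0}^n\not\supset\mathcal{N}(S_i)\}$, and $L_n=\sharp H_n$ is its cardinality (number of distinct points). The independent dual walk $\{S'_m\}_{m\ge0}$ is a process independent of $\{S_m\}_{m\ge 0}$ with the same law as $\{-S_m\}_{m\ge0}$. Notation such as $\{S_m\}_{m=0}^{\infty}$ inside set relations denotes the set of sites visited. *)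

theory Defs
  imports "HOL-Probability.Probability"
begin

text \<open>
  The lattice \<open>\<int>\<^sup>d\<close> is the type \<open>int ^ 'd\<close>, with its discrete sigma-algebra. As \<open>int\<close> is not
  a metric space in the library, the Euclidean distance is taken in \<open>real ^ 'd\<close>.
\<close>

definition embed :: "int ^ 'd \<Rightarrow> real ^ 'd" where
  "embed a = (\<chi> i. real_of_int (a $ i))"

definition neighbours :: "int ^ 'd \<Rightarrow> (int ^ 'd) set" where
  "neighbours a = {z. dist (embed a) (embed z) = 1}"

text \<open>The steps are indexed from 1; \<open>X 0\<close> is irrelevant.\<close>

locale random_walk = prob_space M
  for M :: "'w measure" and X :: "nat \<Rightarrow> 'w \<Rightarrow> int ^ 'd" +
  assumes indep_steps: "indep_vars (\<lambda>_. count_space UNIV) X {1..}"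
    and identical_steps:
      "\<And>i. i \<ge> 1 \<Longrightarrow> distr M (count_space UNIV) (X i) = distr M (count_space UNIV) (X 1)"

definition walk :: "(nat \<Rightarrow> 'w \<Rightarrow> int ^ 'd) \<Rightarrow> nat \<Rightarrow> 'w \<Rightarrow> int ^ 'd" where
  "walk X k \<omega> = (\<Sum>i = 1..k. X i \<omega>)"

definition inner_boundary :: "(nat \<Rightarrow> 'w \<Rightarrow> int ^ 'd) \<Rightarrow> nat \<Rightarrow> 'w \<Rightarrow> (int ^ 'd) set" where
  "inner_boundary S n \<omega> =
     {S i \<omega> | i. i \<le> n \<and> \<not> neighbours (S i \<omega>) \<subseteq> {S m \<omega> | m. m \<le> n}}"

definition num_inner_boundary :: "(nat \<Rightarrow> 'w \<Rightarrow> int ^ 'd) \<Rightarrow> nat \<Rightarrow> 'w \<Rightarrow> nat" where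
  "num_inner_boundary S n \<omega> = card (inner_boundary S n \<omega>)"

text \<open>Sigma-algebra on path space; the law of a process is its distribution there.\<close>

abbreviation path_space :: "(nat \<Rightarrow> int ^ 'd) measure" where
  "path_space \<equiv> Pi\<^sub>M UNIV (\<lambda>_. count_space UNIV)"

definition independent_dual_walk ::
    "'w measure \<Rightarrow> (nat \<Rightarrow> 'w \<Rightarrow> int ^ 'd) \<Rightarrow> (nat \<Rightarrow> 'w \<Rightarrow> int ^ 'd) \<Rightarrow> bool" where
  "independent_dual_walk M S S' \<longleftrightarrow>
     prob_space.indep_var M path_space (\<lambda>\<omega> m. S m \<omega>) path_space (\<lambda>\<omega> m. S' m \<omega>) \<and>
     distr M path_space (\<lambda>\<omega> m. S' m \<omega>) = distr M path_space (\<lambda>\<omega> m. - S m \<omega>)"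

end

theory Submission
  imports Defs
begin

text \<open>
  Count each boundary point at its last visit. Seen from its position at time \<open>i\<close>, the walk has an
  independent future and reversed past distributed like \<open>S\<close> and \<open>S'\<close>, so the \<open>i\<close>-th term of
  \<open>L\<^sub>n\<close> has expectation at least \<open>q\<close>, and close to \<open>q\<close> unless \<open>i\<close> is near \<open>0\<close> or \<open>n\<close>. Hence
  \<open>E L\<^sub>n \<ge> n q\<close> and \<open>E L\<^sub>m / m\<close> comes arbitrarily close to \<open>q\<close>.

  As \<open>L\<^sub>n\<close> is subadditive, cutting the walk into independent blocks of length \<open>m\<close> and the law of
  large numbers (Hoeffding and Borel-Cantelli) give \<open>limsup L\<^sub>n / n \<le> E L\<^sub>m / m\<close> almost surely, so
  \<open>limsup L\<^sub>n / n \<le> q\<close>. Conversely \<open>Y = liminf L\<^sub>n / n\<close> is shift invariant almost surely, and covering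
  \<open>{0..<n}\<close> greedily by intervals on which the average of \<open>L\<close> is at most \<open>Y + \<epsilon>\<close> yields
  \<open>q \<le> E L\<^sub>n / n \<le> E Y + \<epsilon> + o(1)\<close>. Together with \<open>Y \<le> q\<close> this forces \<open>Y = q\<close> almost surely.
\<close>

subsection \<open>Subadditive processes\<close>

text \<open>Walk through the interval from left to right. From a time outside \<open>B\<close>, jump
  over a stretch of length \<open>k\<close> at cost at most \<open>k * y\<close>; from a time in
  \<open>B\<close>, advance by one at cost at most \<open>2 * C\<close>. The last stretch, of length
  at most \<open>N\<close>, is paid for by the a priori bound.\<close>

lemma subadditive_greedy_bound:
  fixes g :: "nat \<Rightarrow> nat \<Rightarrow> real"
  assumes sub: "\<And>i m n. g i (m + n) \<le> g i m + g (i + m) n"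
    and bound: "\<And>i n. g i n \<le> C * (real n + 1)" and "0 \<le> C" "0 \<le> y"
    and good: "\<And>i. i \<notin> B \<Longrightarrow> \<exists>k\<in>{1..N}. g i k \<le> real k * y"
  shows "g i n \<le> real n * y + C * (real N + 1) + 2 * C * real (card (B \<inter> {i..<i + n}))"
proof (induction n arbitrary: i rule: less_induct)
  case (less n)
  show ?case
  proof (cases "n \<le> N")
    case True
    have "g i n \<le> C * (real n + 1)" by (rule bound)
    also have "\<dots> \<le> C * (real N + 1)" using True \<open>0 \<le> C\<close> by (intro mult_left_mono) auto
    finally show ?thesis using \<open>0 \<le> C\<close> \<open>0 \<le> y\<close> by (simp add: add_increasing add_increasing2)
  next
    case False
    show ?thesis
    proof (cases "i \<in> B")
      case True
      have n: "n = 1 + (n - 1)" using False by simp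
      have "B \<inter> {i..<i + n} = insert i (B \<inter> {i + 1..<i + 1 + (n - 1)})"
        using True False by auto
      then have "card (B \<inter> {i..<i + n}) = 1 + card (B \<inter> {i + 1..<i + 1 + (n - 1)})"
        by (simp add: card_insert_if)
      moreover have "g i n \<le> g i 1 + g (i + 1) (n - 1)" using sub[of i 1 "n - 1"] n by simp
      moreover have "g i 1 \<le> 2 * C" using bound[of i 1] by simp
      moreover have "g (i + 1) (n - 1) \<le> real (n - 1) * y + C * (real N + 1)
          + 2 * C * real (card (B \<inter> {i + 1..<i + 1 + (n - 1)}))"
        by (rule less.IH) (use False in simp)
      moreover have "real (n - 1) * y \<le> real n * y"
        using \<open>0 \<le> y\<close> by (intro mult_right_mono) auto
      ultimately show ?thesis by (simp add: algebra_simps)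
    next
      case i: False
      then obtain k where k: "1 \<le> k" "k \<le> N" "g i k \<le> real k * y" using good by fastforce
      have n: "n = k + (n - k)" using False k by simp
      have "g i n \<le> g i k + g (i + k) (n - k)" using sub[of i k "n - k"] n by simp
      moreover have "g (i + k) (n - k) \<le> real (n - k) * y + C * (real N + 1)
          + 2 * C * real (card (B \<inter> {i + k..<i + k + (n - k)}))"
        by (rule less.IH) (use False k in simp)
      moreover have "real k * y + real (n - k) * y = real n * y"
        using n by (metis distrib_right of_nat_add)
      \<comment> \<open>Bad times inside the skipped stretch are not charged, so the count can only
        drop.\<close>
      moreover have "card (B \<inter> {i + k..<i + k + (n - k)}) \<le> card (B \<inter> {i..<i + n})"
        using n by (intro card_mono) auto
      then have "2 * C * real (card (B \<inter> {i + k..<i + k + (n - k)})) \<le> 2 * C * real (card (B \<inter> {i..<i + n}))"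
        using \<open>0 \<le> C\<close> by (intro mult_left_mono) auto
      ultimately show ?thesis using k(3) by linarith
    qed
  qed
qed

text \<open>The setting of Kingman's theorem with bounded increments. The bound is affine in
  \<open>n\<close> because a path of \<open>n\<close> steps visits up to \<open>n + 1\<close> sites,
  already one at \<open>n = 0\<close>.\<close>

locale subadditive_process = prob_space M for M :: "'a measure" +
  fixes T :: "'a \<Rightarrow> 'a" and f :: "nat \<Rightarrow> 'a \<Rightarrow> real" and C :: real
  assumes T_measurable[measurable]: "T \<in> M \<rightarrow>\<^sub>M M"
    and T_preserving: "distr M M T = M"
    and f_measurable[measurable]: "\<And>n. f n \<in> borel_measurable M"
    and f_nonneg: "\<And>n x. x \<in> space M \<Longrightarrow> 0 \<le> f n x"
    and f_bound: "\<And>n x. x \<in> space M \<Longrightarrow> f n x \<le> C * (real n + 1)"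
    and f_subadd: "\<And>m n x. x \<in> space M \<Longrightarrow> f (m + n) x \<le> f m x + f n ((T ^^ m) x)"
begin

text \<open>The liminf lies between \<open>0\<close> and \<open>2 * C\<close>, so the conversion
  from extended reals loses nothing.\<close>

definition lower_rate :: "'a \<Rightarrow> real" where
  "lower_rate x = real_of_ereal (liminf (\<lambda>n. ereal (f n x / real n)))"

lemma C_nonneg: "0 \<le> C"
proof -
  obtain x where "x \<in> space M" using not_empty by blast
  then show ?thesis using f_nonneg[of x 0] f_bound[of x 0] by simp
qed

lemma lower_rate_measurable[measurable]: "lower_rate \<in> borel_measurable M"
  unfolding lower_rate_def by measurable

lemma rate_bounds:
  assumes "x \<in> space M"
  shows "0 \<le> f n x / real n" "f n x / real n \<le> 2 * C"
proof -
  show "0 \<le> f n x / real n" using f_nonneg[OF assms] by simp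
  show "f n x / real n \<le> 2 * C"
  proof (cases "n = 0")
    case False
    have "C * (real n + 1) \<le> C * (real n + real n)"
      using False C_nonneg by (intro mult_left_mono) auto
    then show ?thesis using f_bound[OF assms, of n] False by (simp add: field_simps)
  qed (use C_nonneg in simp)
qed

lemma ereal_lower_rate:
  assumes "x \<in> space M"
  shows "ereal (lower_rate x) = liminf (\<lambda>n. ereal (f n x / real n))"
    and "0 \<le> lower_rate x" "lower_rate x \<le> 2 * C"
proof -
  let ?l = "liminf (\<lambda>n. ereal (f n x / real n))"
  have 1: "0 \<le> ?l"
    by (intro Liminf_bounded always_eventually allI) (use rate_bounds[OF assms] in simp)
  have "?l \<le> limsup (\<lambda>n. ereal (f n x / real n))" by (intro Liminf_le_Limsup) simp
  also have "\<dots> \<le> ereal (2 * C)"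
    by (intro Limsup_bounded always_eventually allI) (use rate_bounds[OF assms] in simp)
  finally have 2: "?l \<le> ereal (2 * C)" .
  have "\<bar>?l\<bar> \<noteq> \<infinity>" using 1 2 by auto
  then show eq: "ereal (lower_rate x) = ?l" unfolding lower_rate_def by (simp add: ereal_real)
  show "0 \<le> lower_rate x" using 1 eq by (metis ereal_less_eq(3) zero_ereal_def)
  show "lower_rate x \<le> 2 * C" using 2 eq by (metis ereal_less_eq(3))
qed

text \<open>Otherwise all quotients with \<open>n\<close> at least 1 would exceed the liminf by
  \<open>e\<close>. Positivity of \<open>n\<close> matters: the covering argument must make
  progress.\<close>

lemma frequently_below_lower_rate:
  assumes x: "x \<in> space M" and "0 < e"
  obtains n where "1 \<le> n" "f n x \<le> real n * (lower_rate x + e)"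
proof -
  have "\<not> (\<forall>n\<ge>1. real n * (lower_rate x + e) < f n x)"
  proof
    assume *: "\<forall>n\<ge>1. real n * (lower_rate x + e) < f n x"
    have "\<forall>\<^sub>F n in sequentially. ereal (lower_rate x + e) \<le> ereal (f n x / real n)"
      using eventually_ge_at_top[of 1]
      by eventually_elim (use * in \<open>auto simp: field_simps less_imp_le\<close>)
    then have "ereal (lower_rate x + e) \<le> ereal (lower_rate x)"
      unfolding ereal_lower_rate(1)[OF x] by (rule Liminf_bounded)
    then show False using \<open>0 < e\<close> by simp
  qed
  then show ?thesis using that by (meson not_less)
qed

lemma T_space: "x \<in> space M \<Longrightarrow> T x \<in> space M"
  using T_measurable by (rule measurable_space)

lemma iterate_measurable[measurable]: "(T ^^ i) \<in> M \<rightarrow>\<^sub>M M"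
  by (induction i) (auto intro: measurable_comp[OF _ T_measurable] simp: measurable_ident)

lemma iterate_preserving: "distr M M (T ^^ i) = M"
proof (induction i)
  case (Suc i)
  have "distr M M (T ^^ Suc i) = distr (distr M M (T ^^ i)) M T"
    by (subst distr_distr[OF T_measurable iterate_measurable]) simp
  then show ?case by (simp only: Suc.IH T_preserving)
qed (simp add: distr_id)

lemma iterate_space: "x \<in> space M \<Longrightarrow> (T ^^ i) x \<in> space M"
  using iterate_measurable by (rule measurable_space)

text \<open>Splitting off the first step gives \<open>f (Suc n) x\<close> at most
  \<open>2 * C + f n (T x)\<close>, and the constant vanishes after division by \<open>n\<close>.
  Subadditivity yields only this direction; equality almost surely comes from measure
  preservation.\<close>

lemma lower_rate_le_shift:
  assumes x: "x \<in> space M"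
  shows "lower_rate x \<le> lower_rate (T x)"
proof (rule field_le_epsilon)
  fix e :: real assume "0 < e"
  have "ereal (lower_rate x - e/2) < ereal (lower_rate x)" using \<open>0 < e\<close> by simp
  then have "\<forall>\<^sub>F n in sequentially. ereal (lower_rate x - e/2) < ereal (f n x / real n)"
    unfolding ereal_lower_rate(1)[OF x] by (rule less_LiminfD)
  then have "\<forall>\<^sub>F n in sequentially. lower_rate x - e/2 < f (Suc n) x / real (Suc n)"
    by (subst eventually_sequentially_Suc[where P = "\<lambda>n. lower_rate x - e/2 < f n x / real n"]) simp
  moreover have "(\<lambda>n. 2 * C / real n) \<longlonglongrightarrow> 0" by (rule lim_const_over_n)
  then have "\<forall>\<^sub>F n in sequentially. 2 * C / real n < e/2"
    by (rule order_tendstoD) (use \<open>0 < e\<close> in simp)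
  ultimately have "\<forall>\<^sub>F n in sequentially. ereal (lower_rate x - e) \<le> ereal (f n (T x) / real n)"
    using eventually_gt_at_top[of 0]
  proof eventually_elim
    case (elim n)
    have "f (Suc n) x \<le> 2 * C + f n (T x)"
      using f_subadd[OF x, of 1 n] f_bound[OF x, of 1] by simp
    then have "f (Suc n) x / real (Suc n) \<le> (2 * C + f n (T x)) / real (Suc n)"
      by (intro divide_right_mono) auto
    \<comment> \<open>The numerator is nonnegative, so the smaller denominator enlarges the
      quotient.\<close>
    also have "\<dots> \<le> (2 * C + f n (T x)) / real n"
      using elim C_nonneg f_nonneg[OF T_space[OF x], of n] by (intro divide_left_mono) auto
    finally show ?case using elim by (simp add: add_divide_distrib)
  qed
  then have "ereal (lower_rate x - e) \<le> ereal (lower_rate (T x))"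
    unfolding ereal_lower_rate(1)[OF T_space[OF x]] by (rule Liminf_bounded)
  then show "lower_rate x \<le> lower_rate (T x) + e" by simp
qed

lemma integrable_lower_rate: "integrable M lower_rate"
  by (rule integrable_const_bound[where B = "2 * C"]) (auto intro!: AE_I2 simp: ereal_lower_rate)

lemma integrable_f: "integrable M (f n)"
  by (rule integrable_const_bound[where B = "C * (real n + 1)"])
    (auto intro!: AE_I2 simp: f_nonneg f_bound)

lemma AE_iterate:
  assumes "AE x in M. P x"
  shows "AE x in M. P ((T ^^ i) x)"
  by (rule AE_distrD[OF iterate_measurable, of P i]) (unfold iterate_preserving, rule assms)

text \<open>\<open>lower_rate\<close> and \<open>lower_rate \<circ> T\<close> have the same law and are ordered, so they agree.\<close>

lemma AE_lower_rate_invariant: "AE x in M. \<forall>i. lower_rate ((T ^^ i) x) = lower_rate x"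
proof -
  let ?d = "\<lambda>x. lower_rate (T x) - lower_rate x"
  have int: "integrable M (\<lambda>x. lower_rate (T x))"
    using integrable_distr[OF T_measurable, of lower_rate] integrable_lower_rate
    by (simp add: T_preserving)
  have "expectation (\<lambda>x. lower_rate (T x)) = expectation lower_rate"
    using integral_distr[OF T_measurable lower_rate_measurable] by (simp add: T_preserving)
  then have "expectation ?d = 0" using int integrable_lower_rate by simp
  moreover have "AE x in M. 0 \<le> ?d x" by (auto intro!: AE_I2 simp: lower_rate_le_shift)
  ultimately have "AE x in M. ?d x = 0"
    using integral_nonneg_eq_0_iff_AE[of M ?d] int integrable_lower_rate by simp
  then have "AE x in M. \<forall>i. ?d ((T ^^ i) x) = 0"
    unfolding AE_all_countable by (intro allI AE_iterate)
  then show ?thesis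
  proof eventually_elim
    case (elim x)
    show ?case
    proof
      fix i show "lower_rate ((T ^^ i) x) = lower_rate x"
        by (induction i) (use elim in auto)
    qed
  qed
qed

text \<open>The covering argument of Katznelson and Weiss.\<close>

lemma expectation_lower_rate_ge:
  assumes q: "\<And>n. real n * q \<le> expectation (f n)"
  shows "q \<le> expectation lower_rate"
proof (rule field_le_epsilon)
  fix e :: real assume "0 < e"
  define e' where "e' = e / 2"
  have e': "0 < e'" using \<open>0 < e\<close> by (simp add: e'_def)
  \<comment> \<open>Points from which no interval of length at most \<open>N\<close> has a small
    average. These sets decrease to the empty set, so their probability is eventually
    negligible.\<close>
  define B where "B N = {x \<in> space M. \<forall>k\<in>{1..N}. real k * (lower_rate x + e') < f k x}" for N
  have [measurable]: "B N \<in> sets M" for N unfolding B_def by measurable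
  have "(\<lambda>N. prob (B N)) \<longlonglongrightarrow> prob (\<Inter>N. B N)"
    by (rule finite_Lim_measure_decseq) (auto simp: decseq_def B_def)
  moreover have "(\<Inter>N. B N) = {}"
  proof -
    have "x \<notin> (\<Inter>N. B N)" for x
    proof (cases "x \<in> space M")
      case True
      then obtain n where "1 \<le> n" "f n x \<le> real n * (lower_rate x + e')"
        using frequently_below_lower_rate e' by blast
      then have "x \<notin> B n" unfolding B_def by force
      then show ?thesis by blast
    qed (auto simp: B_def)
    then show ?thesis by blast
  qed
  ultimately have "(\<lambda>N. 2 * C * prob (B N)) \<longlonglongrightarrow> 0"
    using tendsto_mult_left[of "\<lambda>N. prob (B N)" 0 sequentially "2 * C"] by simp
  then have "\<forall>\<^sub>F N in sequentially. 2 * C * prob (B N) < e'"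
    using e' by (rule order_tendstoD)
  then obtain N where N: "2 * C * prob (B N) < e'"
    by (auto simp: eventually_sequentially)
  \<comment> \<open>Integrate the greedy bound along the orbit: since \<open>T\<close> preserves the
    measure, the expected number of bad times before \<open>n\<close> is
    \<open>n * prob (B N)\<close>.\<close>
  have key: "real n * q \<le> real n * (expectation lower_rate + e') + C * (real N + 1) + real n * (2 * C * prob (B N))"
    for n
  proof -
    let ?b = "\<lambda>i x. indicator (B N) ((T ^^ i) x) :: real"
    have int_b: "integrable M (?b i)" "expectation (?b i) = prob (B N)" for i
    proof -
      show "integrable M (?b i)"
        by (rule integrable_const_bound[where B = 1]) (auto simp: indicator_def)
      have "expectation (?b i) = integral\<^sup>L (distr M M (T ^^ i)) (indicator (B N))"
        by (rule integral_distr[symmetric]) auto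
      then show "expectation (?b i) = prob (B N)" by (simp add: iterate_preserving)
    qed
    have "AE x in M. f n x \<le> real n * (lower_rate x + e') + C * (real N + 1) + 2 * C * (\<Sum>i<n. ?b i x)"
      using AE_lower_rate_invariant AE_space
    proof eventually_elim
      case (elim x)
      \<comment> \<open>Invariance of \<open>lower_rate\<close> along the orbit gives one target
        average for all starting times, as the greedy bound requires.\<close>
      let ?D = "{i. (T ^^ i) x \<in> B N}"
      have "f n ((T ^^ 0) x) \<le> real n * (lower_rate x + e') + C * (real N + 1)
         + 2 * C * real (card (?D \<inter> {0..<0 + n}))"
      proof (rule subadditive_greedy_bound[where g = "\<lambda>i n. f n ((T ^^ i) x)"])
        show "f (m + n) ((T ^^ i) x) \<le> f m ((T ^^ i) x) + f n ((T ^^ (i + m)) x)" for i m n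
          using f_subadd[OF iterate_space[OF elim(2)], of m n i]
          by (simp add: funpow_add add.commute[of i m])
        show "f n ((T ^^ i) x) \<le> C * (real n + 1)" for i n
          by (rule f_bound[OF iterate_space[OF elim(2)]])
        show "\<exists>k\<in>{1..N}. f k ((T ^^ i) x) \<le> real k * (lower_rate x + e')" if "i \<notin> ?D" for i
          using that elim iterate_space[OF elim(2), of i] unfolding B_def by (auto simp: not_less)
      qed (use C_nonneg e' ereal_lower_rate(2)[OF elim(2)] in auto)
      moreover have "real (card (?D \<inter> {0..<0 + n})) = (\<Sum>i<n. ?b i x)"
        by (simp add: indicator_def Int_commute lessThan_atLeast0)
      ultimately show ?case by simp
    qed
    then have "expectation (f n) \<le> expectation (\<lambda>x. real n * (lower_rate x + e') + C * (real N + 1) + 2 * C * (\<Sum>i<n. ?b i x))"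
      by (intro integral_mono_AE integrable_f Bochner_Integration.integrable_add
            integrable_mult_right Bochner_Integration.integrable_sum integrable_lower_rate int_b
            integrable_const)
    also have "\<dots> = real n * (expectation lower_rate + e') + C * (real N + 1) + real n * (2 * C * prob (B N))"
      by (simp add: integrable_lower_rate int_b prob_space)
    finally show ?thesis using q[of n] by linarith
  qed
  have "q \<le> (expectation lower_rate + e') + 2 * C * prob (B N)"
  proof (rule LIMSEQ_le_const)
    let ?r = "expectation lower_rate + e' + 2 * C * prob (B N)"
    have "(\<lambda>n. ?r + C * (real N + 1) / real n) \<longlonglongrightarrow> ?r + 0"
      by (intro tendsto_intros lim_const_over_n)
    then show "(\<lambda>n. ?r + C * (real N + 1) / real n) \<longlonglongrightarrow> ?r" by simp
    have "q \<le> ?r + C * (real N + 1) / real n" if "1 \<le> n" for n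
      using key[of n] that by (simp add: field_simps)
    then show "\<exists>k. \<forall>n\<ge>k. q \<le> ?r + C * (real N + 1) / real n" by blast
  qed
  \<comment> \<open>Two errors remain, each at most \<open>e' = e / 2\<close>: the slack in the
    average and the cost of bad times.\<close>
  then show "q \<le> expectation lower_rate + e" using N by (simp add: e'_def)
qed

text \<open>By \<open>upper\<close>, the limsup and hence \<open>lower_rate\<close> is at most
  \<open>q\<close>; by \<open>lower\<close>, its mean is at least \<open>q\<close>. So the
  nonnegative function \<open>q - lower_rate\<close> has integral zero and vanishes almost surely,
  and liminf and limsup meet at \<open>q\<close>.\<close>

lemma AE_tendsto:
  assumes lower: "\<And>n. real n * q \<le> expectation (f n)"
    and upper: "\<And>e. 0 < e \<Longrightarrow> AE x in M. \<forall>\<^sub>F n in sequentially. f n x / real n \<le> q + e"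
  shows "AE x in M. (\<lambda>n. f n x / real n) \<longlonglongrightarrow> q"
proof -
  \<comment> \<open>Countably many tolerances suffice, so the exceptional null sets can be
    united.\<close>
  have "AE x in M. \<forall>k. \<forall>\<^sub>F n in sequentially. f n x / real n \<le> q + 1 / real (Suc k)"
    unfolding AE_all_countable by (intro allI upper) simp
  then have lim: "AE x in M. limsup (\<lambda>n. ereal (f n x / real n)) \<le> ereal q"
  proof eventually_elim
    case (elim x)
    show ?case
    proof (rule ereal_le_epsilon2)
      fix e :: real assume "0 < e"
      then obtain k where k: "1 / real (Suc k) < e" using nat_approx_posE by blast
      have "limsup (\<lambda>n. ereal (f n x / real n)) \<le> ereal (q + 1 / real (Suc k))"
        by (rule Limsup_bounded) (use elim in simp)
      also have "\<dots> \<le> ereal q + ereal e" using k by simp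
      finally show "limsup (\<lambda>n. ereal (f n x / real n)) \<le> ereal q + ereal e" .
    qed
  qed
  have le: "AE x in M. 0 \<le> q - lower_rate x"
    using lim AE_space
  proof eventually_elim
    case (elim x)
    have "ereal (lower_rate x) \<le> limsup (\<lambda>n. ereal (f n x / real n))"
      unfolding ereal_lower_rate(1)[OF elim(2)] by (intro Liminf_le_Limsup) simp
    then have "ereal (lower_rate x) \<le> ereal q" using elim(1) by (rule order_trans)
    then show ?case by simp
  qed
  have int: "integrable M (\<lambda>x. q - lower_rate x)" using integrable_lower_rate by simp
  have "expectation (\<lambda>x. q - lower_rate x) \<le> 0"
    using expectation_lower_rate_ge[OF lower] integrable_lower_rate by (simp add: prob_space)
  moreover have "0 \<le> expectation (\<lambda>x. q - lower_rate x)" using le by (rule integral_nonneg_AE)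
  ultimately have "AE x in M. q - lower_rate x = 0"
    using integral_nonneg_eq_0_iff_AE[OF int le] by simp
  then show ?thesis using lim AE_space
  proof eventually_elim
    case (elim x)
    have "ereal q = liminf (\<lambda>n. ereal (f n x / real n))"
      using elim(1) ereal_lower_rate(1)[OF elim(3)] by simp
    then have "(\<lambda>n. ereal (f n x / real n)) \<longlonglongrightarrow> ereal q"
      using elim(2) Liminf_le_Limsup[of sequentially "\<lambda>n. ereal (f n x / real n)"]
      by (intro Liminf_eq_Limsup) auto
    then show ?case by simp
  qed
qed

end

section \<open>The almost sure upper bound from independent blocks\<close>

lemma (in prob_space) AE_iid_average_less:
  fixes Z :: "nat \<Rightarrow> 'a \<Rightarrow> real"
  assumes indep: "indep_vars (\<lambda>_. borel) Z UNIV"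
    and distr: "\<And>j. distr M borel (Z j) = distr M borel (Z 0)"
    and bounds: "\<And>x. x \<in> space M \<Longrightarrow> Z 0 x \<in> {0..b}"
    and "0 < b" "0 < e"
  shows "AE x in M. \<forall>\<^sub>F n in sequentially. (\<Sum>j<n. Z j x) < real n * (expectation (Z 0) + e)"
proof -
  have [measurable]: "Z j \<in> borel_measurable M" for j using indep by (auto simp: indep_vars_def)
  define A where "A n = {x \<in> space M. real n * expectation (Z 0) + real n * e \<le> (\<Sum>j<n. Z j x)}" for n
  have [measurable]: "A n \<in> sets M" for n unfolding A_def by measurable
  \<comment> \<open>Hoeffding's exponent for a deviation \<open>n * e\<close> is linear in
    \<open>n\<close>, so the tail is at most \<open>r ^ n\<close>, a summable geometric sequence,
    and Borel-Cantelli applies.\<close>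
  define r where "r = exp (- 2 * e\<^sup>2 / b\<^sup>2)"
  have r: "0 \<le> r" "r < 1" using \<open>0 < b\<close> \<open>0 < e\<close> by (simp_all add: r_def divide_neg_pos)
  have A: "prob (A n) \<le> r ^ n" for n
  proof (cases "n = 0")
    case False
    have "Hoeffding_ineq_iid M {..<n} Z (Z 0) 0 b"
    proof unfold_locales
      show "indep_vars (\<lambda>_. borel) Z {..<n}" using indep by (rule indep_vars_subset) simp
      show "AE x in M. Z 0 x \<in> {0..b}" using bounds by (intro AE_I2)
      show "distr M borel (Z i) = distr M borel (Z 0)" for i by (rule distr)
    qed simp_all
    from Hoeffding_ineq_iid.Hoeffding_ineq_ge[OF this, of "real n * e"]
    have "prob (A n) \<le> exp (- 2 * (real n * e)\<^sup>2 / (real n * (b - 0)\<^sup>2))"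
      using False \<open>0 < b\<close> \<open>0 < e\<close> by (simp add: A_def lessThan_empty_iff)
    also have "(- 2 * (real n * e)\<^sup>2 / (real n * (b - 0)\<^sup>2)) = real n * (- 2 * e\<^sup>2 / b\<^sup>2)"
      using False by (simp add: power2_eq_square field_simps)
    also have "exp \<dots> = r ^ n" by (simp only: r_def exp_of_nat_mult)
    finally show ?thesis .
  qed simp
  have "summable (\<lambda>n. prob (A n))"
    by (rule summable_comparison_test[OF _ summable_geometric[of r]]) (use A r in auto)
  then have "AE x in M. \<forall>\<^sub>F n in sequentially. x \<in> space M - A n"
    by (intro borel_cantelli_AE1) (auto simp: emeasure_eq_measure)
  then show ?thesis
  proof eventually_elim
    case (elim x)
    then show ?case by eventually_elim (auto simp: A_def algebra_simps)
  qed
qed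

context subadditive_process
begin

text \<open>Each induction step moves one block out of the remainder, which is why \<open>r\<close>
  must be arbitrary.\<close>

lemma f_blocks:
  assumes "x \<in> space M"
  shows "f (a * m + r) x \<le> (\<Sum>j<a. f m ((T ^^ (j * m)) x)) + f r ((T ^^ (a * m)) x)"
  using assms
proof (induction a arbitrary: r)
  case (Suc a)
  have "f (Suc a * m + r) x = f (a * m + (m + r)) x" by (simp add: algebra_simps)
  also have "\<dots> \<le> (\<Sum>j<a. f m ((T ^^ (j * m)) x)) + f (m + r) ((T ^^ (a * m)) x)"
    using Suc.prems by (rule Suc.IH)
  also have "f (m + r) ((T ^^ (a * m)) x) \<le> f m ((T ^^ (a * m)) x) + f r ((T ^^ m) ((T ^^ (a * m)) x))"
    by (rule f_subadd[OF iterate_space[OF Suc.prems]])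
  also have "(T ^^ m) ((T ^^ (a * m)) x) = (T ^^ (Suc a * m)) x" by (simp add: funpow_add)
  finally show ?case by (simp add: add.assoc)
qed simp

text \<open>Write \<open>n\<close> as \<open>n div m\<close> full blocks plus a remainder shorter
  than \<open>m\<close>. The blocks obey the law of large numbers and the remainder costs at most
  \<open>C * m\<close>; each part takes half of \<open>e\<close>.\<close>

lemma AE_eventually_le_block_average:
  assumes indep: "indep_vars (\<lambda>_. borel) (\<lambda>j x. f m ((T ^^ (j * m)) x)) UNIV"
    and "0 < m" "0 < e"
  shows "AE x in M. \<forall>\<^sub>F n in sequentially. f n x / real n \<le> expectation (f m) / real m + e"
proof -
  let ?Z = "\<lambda>j x. f m ((T ^^ (j * m)) x)" and ?\<mu> = "expectation (f m)"
  have distr: "distr M borel (?Z j) = distr M borel (f m)" for j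
    using distr_distr[OF f_measurable[of m] iterate_measurable[of "j * m"]]
    unfolding iterate_preserving by (simp add: comp_def)
  have "AE x in M. \<forall>\<^sub>F n in sequentially. (\<Sum>j<n. ?Z j x) < real n * (expectation (?Z 0) + e / 2)"
  proof (rule AE_iid_average_less[OF indep])
    show "distr M borel (?Z j) = distr M borel (?Z 0)" for j
      using distr[of j] distr[of 0] by simp
    \<comment> \<open>The extra 1 keeps the range nondegenerate when \<open>C = 0\<close>.\<close>
    show "?Z 0 x \<in> {0..C * (real m + 1) + 1}" if "x \<in> space M" for x
      using f_nonneg[OF that, of m] f_bound[OF that, of m] by simp
    show "0 < C * (real m + 1) + 1" using C_nonneg by (simp add: add_nonneg_pos)
  qed (use \<open>0 < e\<close> in simp)
  then show ?thesis using AE_space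
  proof eventually_elim
    case (elim x)
    have "filterlim (\<lambda>n. n div m) sequentially sequentially"
      unfolding filterlim_at_top
    proof
      fix Z show "\<forall>\<^sub>F n in sequentially. Z \<le> n div m"
        using eventually_ge_at_top[of "Z * m"]
        by eventually_elim (use \<open>0 < m\<close> in \<open>simp add: less_eq_div_iff_mult_less_eq\<close>)
    qed
    then have "\<forall>\<^sub>F n in sequentially. (\<Sum>j<n div m. ?Z j x) < real (n div m) * (expectation (?Z 0) + e / 2)"
      by (rule eventually_compose_filterlim[OF elim(1)])
    moreover have "(\<lambda>n. C * real m / real n) \<longlonglongrightarrow> 0" by (rule lim_const_over_n)
    then have "\<forall>\<^sub>F n in sequentially. C * real m / real n < e / 2"
      by (rule order_tendstoD) (use \<open>0 < e\<close> in simp)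
    ultimately show ?case using eventually_gt_at_top[of 0]
    proof eventually_elim
      case (elim n)
      let ?a = "n div m"
      have "0 \<le> ?\<mu>" by (rule Bochner_Integration.integral_nonneg) (simp add: f_nonneg)
      have "f n x \<le> (\<Sum>j<?a. ?Z j x) + f (n mod m) ((T ^^ (?a * m)) x)"
        using f_blocks[OF \<open>x \<in> space M\<close>, of ?a m "n mod m"] by simp
      moreover have "f (n mod m) ((T ^^ (?a * m)) x) \<le> C * (real (n mod m) + 1)"
        by (rule f_bound[OF iterate_space[OF \<open>x \<in> space M\<close>]])
      moreover have "real (n mod m) + 1 \<le> real m"
        using mod_less_divisor[OF \<open>0 < m\<close>, of n] by linarith
      then have "C * (real (n mod m) + 1) \<le> C * real m"
        using C_nonneg by (intro mult_left_mono)
      \<comment> \<open>Replacing \<open>n div m\<close> by the larger \<open>n / m\<close> is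
        harmless since the mean is nonnegative.\<close>
      moreover have "real ?a * (?\<mu> + e / 2) \<le> (real n / real m) * (?\<mu> + e / 2)"
        using \<open>0 \<le> ?\<mu>\<close> \<open>0 < e\<close> by (intro mult_right_mono of_nat_div_le_of_nat) auto
      ultimately have "f n x \<le> (real n / real m) * (?\<mu> + e / 2) + C * real m"
        using elim(1) by simp
      then have "f n x / real n \<le> ((real n / real m) * (?\<mu> + e / 2) + C * real m) / real n"
        by (rule divide_right_mono) simp
      also have "\<dots> = (?\<mu> + e / 2) / real m + C * real m / real n"
        using \<open>0 < n\<close> \<open>0 < m\<close> by (simp add: field_simps)
      also have "\<dots> \<le> ?\<mu> / real m + e / 2 / real m + e / 2"
        using elim(2) by (simp add: add_divide_distrib)
      also have "e / 2 / real m \<le> e / 2 / 1"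
        using \<open>0 < m\<close> \<open>0 < e\<close> by (intro divide_left_mono) auto
      finally show ?case by simp
    qed
  qed
qed

end

subsection \<open>Boundary points along a path\<close>

lemma neighbours_shift: "z \<in> neighbours a \<longleftrightarrow> z - a \<in> neighbours 0"
proof -
  have "embed 0 - embed (z - a) = embed a - embed z"
    by (simp add: embed_def vec_eq_iff)
  then show ?thesis by (simp add: neighbours_def dist_norm)
qed

text \<open>A vector of norm 1 has coordinates of absolute value at most 1, so the neighbours lie in
  a finite cube.\<close>

lemma finite_neighbours: "finite (neighbours (0 :: int ^ 'd))"
proof (rule finite_subset)
  let ?F = "{f :: 'd \<Rightarrow> int. \<forall>i. f i \<in> {-1..1}}"
  show "neighbours (0 :: int ^ 'd) \<subseteq> vec_lambda ` ?F"
  proof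
    fix z :: "int ^ 'd" assume "z \<in> neighbours 0"
    then have "norm (embed z) = 1"
      by (simp add: neighbours_def dist_norm embed_def norm_minus_commute flip: zero_vec_def)
    then have "\<bar>real_of_int (z $ i)\<bar> \<le> 1" for i
      using component_le_norm_cart[of "embed z" i] by (simp add: embed_def)
    then have "vec_nth z \<in> ?F" by (auto simp: abs_le_iff) (smt (verit) of_int_le_1_iff of_int_minus)+
    then show "z \<in> vec_lambda ` ?F" by (metis image_eqI vec_nth_inverse)
  qed
  have "?F = (\<Pi>\<^sub>E i\<in>UNIV. {-1..1})" by (auto simp: PiE_def)
  then show "finite (vec_lambda ` ?F)" by (simp add: finite_PiE)
qed

text \<open>The inner boundary depends on the set of visited sites alone; this form makes unions and
  translations easy to treat.\<close>

definition boundary :: "(int ^ 'd) set \<Rightarrow> (int ^ 'd) set" where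
  "boundary A = {a \<in> A. \<not> neighbours a \<subseteq> A}"

text \<open>Steps are indexed from 0 here: entry \<open>i\<close> of the sequence stands for
  \<open>X (Suc i)\<close>.\<close>

definition partial_sum :: "(nat \<Rightarrow> 'a::comm_monoid_add) \<Rightarrow> nat \<Rightarrow> 'a" where
  "partial_sum x k = (\<Sum>i<k. x i)"

definition boundary_count :: "nat \<Rightarrow> (nat \<Rightarrow> int ^ 'd) \<Rightarrow> nat" where
  "boundary_count n x = card (boundary (partial_sum x ` {..n}))"

definition shift :: "(nat \<Rightarrow> 'a) \<Rightarrow> nat \<Rightarrow> 'a" where
  "shift x = (\<lambda>i. x (Suc i))"

lemma shift_funpow: "(shift ^^ m) x i = x (i + m)"
  by (induction m arbitrary: i) (simp_all add: shift_def)

lemma partial_sum_0[simp]: "partial_sum x 0 = 0" by (simp add: partial_sum_def)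

lemma partial_sum_add: "partial_sum x (m + n) = partial_sum x m + partial_sum ((shift ^^ m) x) n"
  unfolding partial_sum_def shift_funpow
  by (induction n) (simp_all add: add.assoc add.commute[of m])

lemma walk_eq_partial_sum: "walk X k \<omega> = partial_sum (\<lambda>i. X (Suc i) \<omega>) k"
  unfolding walk_def partial_sum_def by (simp add: sum.atLeast1_atMost_eq)

lemma num_inner_boundary_eq: "num_inner_boundary (walk X) n \<omega> = boundary_count n (\<lambda>i. X (Suc i) \<omega>)"
proof -
  have "{walk X m \<omega> | m. m \<le> n} = partial_sum (\<lambda>i. X (Suc i) \<omega>) ` {..n}"
    by (auto simp: walk_eq_partial_sum)
  then have "inner_boundary (walk X) n \<omega> = boundary (partial_sum (\<lambda>i. X (Suc i) \<omega>) ` {..n})"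
    unfolding inner_boundary_def boundary_def by (auto simp: walk_eq_partial_sum)
  then show ?thesis by (simp add: num_inner_boundary_def boundary_count_def)
qed

text \<open>A neighbour missing from the union is missing from both sets. This is the source of
  subadditivity.\<close>

lemma boundary_Un: "boundary (A \<union> B) \<subseteq> boundary A \<union> boundary B"
  by (auto simp: boundary_def)

lemma boundary_translate: "boundary ((+) a ` A) = (+) a ` boundary A"
proof -
  have "neighbours (a + b) \<subseteq> (+) a ` A \<longleftrightarrow> neighbours b \<subseteq> A" for b
  proof -
    have "neighbours (a + b) = (+) a ` neighbours b"
    proof (intro set_eqI iffI)
      fix z assume "z \<in> neighbours (a + b)"
      then have "z - a \<in> neighbours b"
        by (simp add: neighbours_shift[of _ "a + b"] neighbours_shift[of _ b] algebra_simps)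
      then show "z \<in> (+) a ` neighbours b" by (rule rev_image_eqI) simp
    next
      fix z assume "z \<in> (+) a ` neighbours b"
      then obtain y where "z = a + y" "y - b \<in> neighbours 0" using neighbours_shift by blast
      then show "z \<in> neighbours (a + b)" by (simp add: neighbours_shift[of _ "a + b"])
    qed
    then show ?thesis by (simp add: inj_image_subset_iff)
  qed
  then show ?thesis by (simp only: boundary_def Compr_image_eq)
qed

lemma boundary_count_le: "boundary_count n x \<le> n + 1"
proof -
  have "boundary_count n x \<le> card (partial_sum x ` {..n})"
    unfolding boundary_count_def by (intro card_mono) (auto simp: boundary_def)
  also have "\<dots> \<le> card {..n}" by (rule card_image_le) simp
  finally show ?thesis by simp
qed

text \<open>The range up to time \<open>m + n\<close> is the range up to \<open>m\<close> together
  with a translate of the range of the shifted path, both containing the site at time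
  \<open>m\<close>.\<close>

lemma boundary_count_add: "boundary_count (m + n) x \<le> boundary_count m x + boundary_count n ((shift ^^ m) x)"
proof -
  let ?y = "(shift ^^ m) x"
  let ?A = "partial_sum x ` {..m}" and ?B = "(+) (partial_sum x m) ` partial_sum ?y ` {..n}"
  have split: "{..m + n} = {..m} \<union> (+) m ` {..n}"
    by (auto simp: image_iff) (metis atMost_iff le_add_diff_inverse nat_add_left_cancel_le nle_le)
  have eq: "partial_sum x ` {..m + n} = ?A \<union> ?B"
    unfolding split image_Un image_image partial_sum_add ..
  have fin: "finite (boundary ?A)" "finite (boundary ?B)" by (simp_all add: boundary_def)
  have "boundary_count (m + n) x \<le> card (boundary ?A \<union> boundary ?B)"
    unfolding boundary_count_def eq using fin by (intro card_mono boundary_Un) auto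
  also have "\<dots> \<le> card (boundary ?A) + card (boundary ?B)" by (rule card_Un_le)
  also have "card (boundary ?B) = boundary_count n ?y"
    unfolding boundary_translate boundary_count_def by (rule card_image) simp
  finally show ?thesis by (simp add: boundary_count_def)
qed

text \<open>The event of the limit theorem with the dual walk \<open>- partial_sum v\<close> cut off at time \<open>k\<close> and
  the walk \<open>partial_sum u\<close> cut off at time \<open>l\<close>.\<close>

definition window_event :: "nat \<Rightarrow> nat \<Rightarrow> (nat \<Rightarrow> int ^ 'd) \<Rightarrow> (nat \<Rightarrow> int ^ 'd) \<Rightarrow> bool" where
  "window_event k l u v \<longleftrightarrow> (\<forall>j\<in>{1..l}. partial_sum u j \<noteq> 0) \<and>
     (\<exists>e\<in>neighbours 0. (\<forall>j\<le>l. partial_sum u j \<noteq> e) \<and> (\<forall>j\<le>k. - partial_sum v j \<noteq> e))"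

lemma window_event_antimono:
  "k \<le> k' \<Longrightarrow> l \<le> l' \<Longrightarrow> window_event k' l' u v \<Longrightarrow> window_event k l u v"
  unfolding window_event_def by (meson atLeastAtMost_iff order_trans)

text \<open>The unvisited neighbour may vary with \<open>k\<close>. But if each of the finitely many
  neighbours were hit, all would be hit by a common time \<open>k\<close>, contradicting the event
  for that \<open>k\<close>.\<close>

lemma all_window_event_iff:
  "(\<forall>k. window_event k k u v) \<longleftrightarrow>
    \<not> neighbours 0 \<subseteq> range (partial_sum u) \<union> range (\<lambda>j. - partial_sum v j) \<and>
    0 \<notin> {partial_sum u j | j. 1 \<le> j}" (is "?L \<longleftrightarrow> ?R")
proof
  assume ?R
  then obtain e where "e \<in> neighbours 0" "e \<notin> range (partial_sum u)" "e \<notin> range (\<lambda>j. - partial_sum v j)"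
    by blast
  moreover have "partial_sum u j \<noteq> 0" if "1 \<le> j" for j using \<open>?R\<close> that by force
  ultimately show ?L unfolding window_event_def by fastforce
next
  assume L: ?L
  have "\<exists>e\<in>neighbours 0. e \<notin> range (partial_sum u) \<and> e \<notin> range (\<lambda>j. - partial_sum v j)"
  proof (rule ccontr)
    assume "\<not> ?thesis"
    then have "\<forall>e\<in>neighbours 0. \<exists>j. partial_sum u j = e \<or> - partial_sum v j = e"
      by (metis rangeE)
    then obtain J where J: "\<forall>e\<in>neighbours 0. partial_sum u (J e) = e \<or> - partial_sum v (J e) = e"
      by (auto simp: bchoice_iff)
    obtain k where k: "\<forall>j\<in>J ` neighbours 0. j \<le> k"
      using finite_imageI[OF finite_neighbours, of J] finite_nat_set_iff_bounded_le by metis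
    from L have "window_event k k u v" by blast
    then show False using J k unfolding window_event_def by blast
  qed
  moreover have "partial_sum u j \<noteq> 0" if "1 \<le> j" for j
    using L[rule_format, of j] that by (simp add: window_event_def)
  ultimately show ?R by force
qed

text \<open>Every boundary point is counted at its last visit up to time \<open>n\<close>.\<close>

lemma boundary_count_eq:
  "boundary_count n x = card {i. i \<le> n \<and> (\<forall>j\<in>{i<..n}. partial_sum x j \<noteq> partial_sum x i) \<and>
     (\<exists>z\<in>neighbours (partial_sum x i). \<forall>j\<le>n. partial_sum x j \<noteq> z)}" (is "_ = card ?I")
proof -
  let ?s = "partial_sum x"
  have "bij_betw ?s ?I (boundary (?s ` {..n}))"
    unfolding bij_betw_def
  proof
    show "inj_on ?s ?I"
    proof (rule inj_onI)
      fix i j assume "i \<in> ?I" "j \<in> ?I" "?s i = ?s j"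
      then show "i = j" by (cases i j rule: linorder_cases) auto
    qed
    show "?s ` ?I = boundary (?s ` {..n})"
    proof
      show "?s ` ?I \<subseteq> boundary (?s ` {..n})" by (fastforce simp: boundary_def)
      show "boundary (?s ` {..n}) \<subseteq> ?s ` ?I"
      proof
        fix a assume a: "a \<in> boundary (?s ` {..n})"
        \<comment> \<open>The last visit to \<open>a\<close>; later visits are excluded by
          maximality.\<close>
        define i where "i = Max {i. i \<le> n \<and> ?s i = a}"
        have fin: "finite {i. i \<le> n \<and> ?s i = a}" by simp
        have "{i. i \<le> n \<and> ?s i = a} \<noteq> {}" using a by (auto simp: boundary_def)
        then have i: "i \<le> n" "?s i = a" using Max_in[OF fin] unfolding i_def by blast+
        have "?s j \<noteq> a" if "j \<in> {i<..n}" for j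
          using Max_ge[OF fin, of j] that unfolding i_def by fastforce
        moreover obtain z where "z \<in> neighbours a" "z \<notin> ?s ` {..n}"
          using a by (auto simp: boundary_def)
        ultimately have "i \<in> ?I" using i by (auto intro!: bexI[of _ z])
        then show "a \<in> ?s ` ?I" using i by blast
      qed
    qed
  qed
  then show ?thesis unfolding boundary_count_def by (simp add: bij_betw_same_card)
qed

text \<open>The walk with steps \<open>glue i v u\<close>, seen from its position at time \<open>i\<close>, has future
  \<open>partial_sum u\<close> and reversed past \<open>- partial_sum v\<close>.\<close>

definition glue :: "nat \<Rightarrow> (nat \<Rightarrow> 'a) \<Rightarrow> (nat \<Rightarrow> 'a) \<Rightarrow> nat \<Rightarrow> 'a" where
  "glue i v u = (\<lambda>j. if j < i then v (i - 1 - j) else u (j - i))"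

lemma partial_sum_glue_ge:
  "partial_sum (glue i v u) (i + j) = partial_sum (glue i v u) i + partial_sum u j"
proof -
  have "(shift ^^ i) (glue i v u) = u" by (rule ext) (simp add: shift_funpow glue_def)
  then show ?thesis by (simp add: partial_sum_add)
qed

text \<open>The first \<open>i\<close> steps are \<open>v\<close> in reverse order, so going back
  \<open>k\<close> steps from time \<open>i\<close> undoes \<open>v 0\<close> to
  \<open>v (k - 1)\<close>.\<close>

lemma partial_sum_glue_le:
  fixes v u :: "nat \<Rightarrow> 'a::ab_group_add"
  shows "k \<le> i \<Longrightarrow> partial_sum (glue i v u) (i - k) = partial_sum (glue i v u) i - partial_sum v k"
proof (induction k)
  case (Suc k)
  have "i - k = Suc (i - Suc k)" using Suc.prems by simp
  then have "partial_sum (glue i v u) (i - k)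
      = partial_sum (glue i v u) (i - Suc k) + glue i v u (i - Suc k)"
    by (simp add: partial_sum_def)
  moreover have "glue i v u (i - Suc k) = v k" using Suc.prems by (simp add: glue_def)
  ultimately show ?case using Suc by (simp add: partial_sum_def algebra_simps)
qed simp

text \<open>Subtracting the position at time \<open>i\<close> turns positions at later times into
  \<open>partial_sum u\<close> and at earlier times into \<open>- partial_sum v\<close>; missing
  neighbours are translated along.\<close>

lemma window_event_glue:
  fixes u v :: "nat \<Rightarrow> int ^ 'd"
  assumes "i \<le> n"
  shows "window_event i (n - i) u v \<longleftrightarrow>
    (\<forall>j\<in>{i<..n}. partial_sum (glue i v u) j \<noteq> partial_sum (glue i v u) i) \<and>
     (\<exists>z\<in>neighbours (partial_sum (glue i v u) i). \<forall>j\<le>n. partial_sum (glue i v u) j \<noteq> z)"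
proof -
  define s where "s = partial_sum (glue i v u)"
  have ge: "s (i + j) = s i + partial_sum u j" for j
    unfolding s_def by (rule partial_sum_glue_ge)
  have le: "s (i - k) = s i - partial_sum v k" if "k \<le> i" for k
    unfolding s_def using that by (rule partial_sum_glue_le)
  have "(\<forall>j\<in>{i<..n}. s j \<noteq> s i) \<longleftrightarrow> (\<forall>j\<in>{1..n - i}. s (i + j) \<noteq> s i)"
  proof (intro iffI ballI)
    fix j assume *: "\<forall>j\<in>{1..n - i}. s (i + j) \<noteq> s i" and "j \<in> {i<..n}"
    then show "s j \<noteq> s i" using *[THEN bspec, of "j - i"] by force
  qed auto
  then have 1: "(\<forall>j\<in>{i<..n}. s j \<noteq> s i) \<longleftrightarrow> (\<forall>j\<in>{1..n - i}. partial_sum u j \<noteq> 0)"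
    by (simp add: ge)
  \<comment> \<open>Times up to \<open>n\<close> are read forwards and backwards from
    \<open>i\<close>, with \<open>i\<close> itself in both lists.\<close>
  have split: "(\<forall>j\<le>n. P j) \<longleftrightarrow> (\<forall>j\<le>n - i. P (i + j)) \<and> (\<forall>k\<le>i. P (i - k))" for P
  proof (intro iffI conjI allI impI)
    fix j assume *: "(\<forall>j\<le>n - i. P (i + j)) \<and> (\<forall>k\<le>i. P (i - k))" and "j \<le> n"
    show "P j"
    proof (cases "j \<le> i")
      case True
      then show ?thesis using *[THEN conjunct2, rule_format, of "i - j"] by simp
    next
      case False
      then show ?thesis using *[THEN conjunct1, rule_format, of "j - i"] \<open>j \<le> n\<close> by simp
    qed
  qed (use assms in auto)
  have nb: "(\<exists>z\<in>neighbours (s i). Q z) \<longleftrightarrow> (\<exists>e\<in>neighbours 0. Q (s i + e))" for Q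
  proof
    assume "\<exists>z\<in>neighbours (s i). Q z"
    then obtain z where "z - s i \<in> neighbours 0" "Q (s i + (z - s i))"
      using neighbours_shift by auto
    then show "\<exists>e\<in>neighbours 0. Q (s i + e)" by blast
  next
    assume "\<exists>e\<in>neighbours 0. Q (s i + e)"
    then show "\<exists>z\<in>neighbours (s i). Q z" using neighbours_shift[of _ "s i"] by fastforce
  qed
  have e: "s (i + j) \<noteq> s i + e \<longleftrightarrow> partial_sum u j \<noteq> e"
    "k \<le> i \<Longrightarrow> s (i - k) \<noteq> s i + e \<longleftrightarrow> - partial_sum v k \<noteq> e" for j k e
    by (simp add: ge) (simp only: le diff_conv_add_uminus add_left_cancel)
  have "(\<exists>z\<in>neighbours (s i). \<forall>j\<le>n. s j \<noteq> z) \<longleftrightarrow>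
    (\<exists>e\<in>neighbours 0. (\<forall>j\<le>n - i. partial_sum u j \<noteq> e) \<and> (\<forall>k\<le>i. - partial_sum v k \<noteq> e))"
    unfolding nb split using e by (auto intro!: bex_cong)
  with 1 show ?thesis unfolding window_event_def s_def by simp
qed

subsection \<open>Independent identically distributed steps\<close>

lemma partial_sum_cong: "(\<And>i. i < n \<Longrightarrow> x i = y i) \<Longrightarrow> k \<le> n \<Longrightarrow> partial_sum x k = partial_sum y k"
  unfolding partial_sum_def by (intro sum.cong) auto

lemma boundary_count_cong:
  assumes "\<And>i. i < n \<Longrightarrow> x i = y i"
  shows "boundary_count n x = boundary_count n y"
proof -
  have "partial_sum x ` {..n} = partial_sum y ` {..n}"
    by (intro image_cong refl partial_sum_cong[of n]) (use assms in auto)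
  then show ?thesis by (simp add: boundary_count_def)
qed

text \<open>The condition counted in \<open>boundary_count_eq\<close>. The neighbour set varies with
  the path, so \<open>z\<close> ranges over the whole countable lattice to make measurability a
  countable union.\<close>

definition last_boundary_visit :: "nat \<Rightarrow> nat \<Rightarrow> (nat \<Rightarrow> int ^ 'd) \<Rightarrow> bool" where
  "last_boundary_visit n i x \<longleftrightarrow> (\<forall>j\<in>{i<..n}. partial_sum x j \<noteq> partial_sum x i) \<and>
     (\<exists>z. z \<in> neighbours (partial_sum x i) \<and> (\<forall>j\<le>n. partial_sum x j \<noteq> z))"

lemma boundary_count_eq_sum:
  "real (boundary_count n x) = (\<Sum>i\<le>n. of_bool (last_boundary_visit n i x))"
proof -
  have "{..n} \<inter> {i. last_boundary_visit n i x} = {i. i \<le> n \<and> (\<forall>j\<in>{i<..n}. partial_sum x j \<noteq> partial_sum x i) \<and>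
     (\<exists>z\<in>neighbours (partial_sum x i). \<forall>j\<le>n. partial_sum x j \<noteq> z)}"
    by (auto simp: last_boundary_visit_def)
  then show ?thesis unfolding boundary_count_eq by simp
qed

text \<open>The law of a single step on the discrete lattice; \<open>P\<close> is the law of an
  i.i.d. sequence of such steps.\<close>

locale step_law = mu: prob_space \<mu> for \<mu> :: "(int ^ 'd) measure" +
  assumes sets_mu: "sets \<mu> = UNIV"
begin

sublocale sequence_space \<mu> by unfold_locales

abbreviation "P \<equiv> Pi\<^sub>M (UNIV :: nat set) (\<lambda>_. \<mu>)"

lemma space_mu: "space \<mu> = UNIV"
  using sets_mu by (metis sets.sets_into_space sets.top top.extremum_uniqueI iso_tuple_UNIV_I)

lemma space_P: "space P = UNIV"
  by (simp add: space_PiM space_mu)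

lemma measurable_mu_iff: "f \<in> N \<rightarrow>\<^sub>M \<mu> \<longleftrightarrow> f \<in> N \<rightarrow>\<^sub>M count_space UNIV"
  by (rule arg_cong[where f = "\<lambda>A. f \<in> A"], rule measurable_cong_sets) (simp_all add: sets_mu)

lemma component_measurable: "(\<lambda>x. x i) \<in> P \<rightarrow>\<^sub>M count_space UNIV"
  using measurable_component_singleton[of i UNIV "\<lambda>_. \<mu>"] by (simp add: measurable_mu_iff)

lemma partial_sum_measurable[measurable]: "(\<lambda>x. partial_sum x k) \<in> P \<rightarrow>\<^sub>M count_space UNIV"
proof (induction k)
  case (Suc k)
  \<comment> \<open>Addition is treated by cases on the countably many values of the earlier
    sum.\<close>
  have "(\<lambda>x. (\<lambda>a x. a + x k) (partial_sum x k) x) \<in> P \<rightarrow>\<^sub>M count_space UNIV"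
    by (rule measurable_compose_countable[OF _ Suc], rule measurable_compose[OF component_measurable]) simp
  then show ?case by (simp add: partial_sum_def)
qed simp

lemma last_boundary_visit_measurable[measurable]: "Measurable.pred P (last_boundary_visit n i)"
proof -
  have [measurable]: "Measurable.pred P (\<lambda>x. z \<in> neighbours (partial_sum x i))" for z
    by (rule measurable_compose[OF partial_sum_measurable]) simp
  have [measurable]: "Measurable.pred P (\<lambda>x. partial_sum x j \<noteq> z)" for j z
    by (rule measurable_compose[OF partial_sum_measurable]) simp
  have "Measurable.pred P (\<lambda>x. (\<lambda>a x. partial_sum x j \<noteq> a) (partial_sum x i) x)" for j
    by (rule measurable_compose_countable[OF _ partial_sum_measurable]) measurable
  then have [measurable]: "Measurable.pred P (\<lambda>x. partial_sum x j \<noteq> partial_sum x i)" for j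
    by simp
  show ?thesis unfolding last_boundary_visit_def by measurable
qed

lemma boundary_count_measurable[measurable]: "(\<lambda>x. real (boundary_count n x)) \<in> borel_measurable P"
  unfolding boundary_count_eq_sum by measurable

lemma window_event_measurable[measurable]:
  "Measurable.pred (P \<Otimes>\<^sub>M P) (\<lambda>w. window_event k l (fst w) (snd w))"
proof -
  have [measurable]: "Measurable.pred (P \<Otimes>\<^sub>M P) (\<lambda>w. partial_sum (fst w) j \<noteq> e)" for j e
    by (rule measurable_compose[OF measurable_compose[OF measurable_fst partial_sum_measurable]]) simp
  have [measurable]: "Measurable.pred (P \<Otimes>\<^sub>M P) (\<lambda>w. - partial_sum (snd w) j \<noteq> e)" for j e
    by (rule measurable_compose[OF measurable_compose[OF measurable_snd partial_sum_measurable]]) simp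
  show ?thesis unfolding window_event_def using finite_neighbours by measurable
qed

text \<open>I.i.d. coordinates may be relabelled injectively; this serves both the shift and the
  time reversal.\<close>

lemma reindex_preserving:
  assumes "inj r"
  shows "distr P P (\<lambda>x j. x (r j)) = P"
  using distr_PiM_reindex[of UNIV "\<lambda>_. \<mu>" r UNIV] assms by (simp add: mu.prob_space_axioms restrict_def)

lemma reindex_measurable: "(\<lambda>x j. x (r j)) \<in> P \<rightarrow>\<^sub>M P"
  by (rule measurable_PiM_single') (auto simp: space_P space_mu intro: measurable_component_singleton)

sublocale PP: pair_prob_space P P ..

text \<open>Gluing is a relabelling of \<open>v\<close> followed by concatenation with
  \<open>u\<close>, and both operations preserve the i.i.d. law.\<close>

lemma glue_measurable: "(\<lambda>(u, v). glue i v u) \<in> P \<Otimes>\<^sub>M P \<rightarrow>\<^sub>M P"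
  and glue_preserving: "distr (P \<Otimes>\<^sub>M P) P (\<lambda>(u, v). glue i v u) = P"
proof -
  \<comment> \<open>Reverses the first \<open>i\<close> indices and fixes the others, hence is
    injective on all of them.\<close>
  define r where "r j = (if j < i then i - 1 - j else j)" for j
  have "inj r" by (rule injI) (auto simp: r_def split: if_splits)
  let ?R = "\<lambda>x j. x (r j)"
  have [measurable]: "?R \<in> P \<rightarrow>\<^sub>M P" by (rule reindex_measurable)
  have comb: "(\<lambda>(x, y). comb_seq i x y) \<in> P \<Otimes>\<^sub>M P \<rightarrow>\<^sub>M P" by measurable
  have swap: "(\<lambda>(u, v). (v, u)) \<in> P \<Otimes>\<^sub>M P \<rightarrow>\<^sub>M P \<Otimes>\<^sub>M P" by measurable
  have map: "(\<lambda>(v, u). (?R v, u)) \<in> P \<Otimes>\<^sub>M P \<rightarrow>\<^sub>M P \<Otimes>\<^sub>M P" by measurable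
  have eq: "(\<lambda>(u, v). glue i v u)
      = (\<lambda>(x, y). comb_seq i x y) \<circ> ((\<lambda>(v, u). (?R v, u)) \<circ> (\<lambda>(u, v). (v, u)))"
    by (auto simp: fun_eq_iff comb_seq_def glue_def r_def)
  have g: "(\<lambda>(v, u). (?R v, u)) \<circ> (\<lambda>(u, v). (v, u)) \<in> P \<Otimes>\<^sub>M P \<rightarrow>\<^sub>M P \<Otimes>\<^sub>M P"
    by (rule measurable_comp[OF swap map])
  show "(\<lambda>(u, v). glue i v u) \<in> P \<Otimes>\<^sub>M P \<rightarrow>\<^sub>M P"
    unfolding eq by (rule measurable_comp[OF g comb])
  have "distr (P \<Otimes>\<^sub>M P) (P \<Otimes>\<^sub>M P) ((\<lambda>(v, u). (?R v, u)) \<circ> (\<lambda>(u, v). (v, u)))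
     = distr (distr (P \<Otimes>\<^sub>M P) (P \<Otimes>\<^sub>M P) (\<lambda>(u, v). (v, u))) (P \<Otimes>\<^sub>M P) (\<lambda>(v, u). (?R v, u))"
    by (rule distr_distr[symmetric]) fact+
  also have "distr (P \<Otimes>\<^sub>M P) (P \<Otimes>\<^sub>M P) (\<lambda>(u, v). (v, u)) = P \<Otimes>\<^sub>M P"
    by (rule PP.distr_pair_swap[symmetric])
  also have "distr (P \<Otimes>\<^sub>M P) (P \<Otimes>\<^sub>M P) (\<lambda>(v, u). (?R v, u))
      = distr P P ?R \<Otimes>\<^sub>M distr P P (\<lambda>u. u)"
    by (rule pair_measure_distr[symmetric]) (auto simp: P.sigma_finite_measure_axioms distr_id)
  also have "\<dots> = P \<Otimes>\<^sub>M P" by (simp add: reindex_preserving[OF \<open>inj r\<close>])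
  finally have *: "distr (P \<Otimes>\<^sub>M P) (P \<Otimes>\<^sub>M P) ((\<lambda>(v, u). (?R v, u)) \<circ> (\<lambda>(u, v). (v, u))) = P \<Otimes>\<^sub>M P" .
  have "distr (P \<Otimes>\<^sub>M P) P (\<lambda>(u, v). glue i v u) = distr (P \<Otimes>\<^sub>M P) P (\<lambda>(x, y). comb_seq i x y)"
    unfolding eq by (subst distr_distr[OF comb g, symmetric]) (simp only: *)
  also have "\<dots> = P" by (rule PiM_comb_seq)
  finally show "distr (P \<Otimes>\<^sub>M P) P (\<lambda>(u, v). glue i v u) = P" .
qed

section \<open>Window probabilities and the mean boundary count\<close>

definition window_prob :: "nat \<Rightarrow> nat \<Rightarrow> real" where
  "window_prob k l = measure (P \<Otimes>\<^sub>M P) {w. window_event k l (fst w) (snd w)}"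

text \<open>The constant q written in terms of step sequences; \<open>escape_probability\<close>
  identifies the two.\<close>

definition rate :: real where
  "rate = measure (P \<Otimes>\<^sub>M P) {w. \<forall>k. window_event k k (fst w) (snd w)}"

lemma space_PP: "space (P \<Otimes>\<^sub>M P) = UNIV"
  by (simp add: space_pair_measure space_P)

lemma window_sets[measurable]: "{w. window_event k l (fst w) (snd w)} \<in> sets (P \<Otimes>\<^sub>M P)"
  using window_event_measurable[of k l] unfolding pred_def space_PP by simp

lemma window_prob_antimono: "k \<le> k' \<Longrightarrow> l \<le> l' \<Longrightarrow> window_prob k' l' \<le> window_prob k l"
  unfolding window_prob_def
  by (rule PP.P.finite_measure_mono) (auto intro: window_event_antimono)

lemma window_prob_le_1: "window_prob k l \<le> 1"
  unfolding window_prob_def by (rule PP.P.prob_le_1)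

lemma window_prob_tendsto: "(\<lambda>k. window_prob k k) \<longlonglongrightarrow> rate"
proof -
  have eq: "{w. \<forall>k. window_event k k (fst w) (snd w)} = (\<Inter>k. {w. window_event k k (fst w) (snd w)})"
    by auto
  show ?thesis unfolding window_prob_def rate_def eq
    by (rule PP.P.finite_Lim_measure_decseq) (auto simp: decseq_def intro: window_event_antimono)
qed

text \<open>The event for all \<open>k\<close> includes the one with both cut-offs equal to
  \<open>max k l\<close>, which implies the one with \<open>k\<close> and \<open>l\<close>.\<close>

lemma rate_le_window_prob: "rate \<le> window_prob k l"
  unfolding window_prob_def rate_def
  by (rule PP.P.finite_measure_mono)
    (auto intro: window_event_antimono[OF max.cobounded1 max.cobounded2])

text \<open>Under \<open>P\<close> a path may be replaced by a glued one, for which the last visit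
  at time \<open>i\<close> is a window event.\<close>

lemma prob_last_boundary_visit:
  assumes "i \<le> n"
  shows "measure P {x. last_boundary_visit n i x} = window_prob i (n - i)"
proof -
  have [measurable]: "{x. last_boundary_visit n i x} \<in> sets P"
    using last_boundary_visit_measurable[of n i] unfolding pred_def space_P by simp
  have "measure P {x. last_boundary_visit n i x}
      = measure (distr (P \<Otimes>\<^sub>M P) P (\<lambda>(u, v). glue i v u)) {x. last_boundary_visit n i x}"
    by (simp only: glue_preserving)
  also have "\<dots> = measure (P \<Otimes>\<^sub>M P)
      ((\<lambda>(u, v). glue i v u) -` {x. last_boundary_visit n i x} \<inter> space (P \<Otimes>\<^sub>M P))"
    by (rule measure_distr[OF glue_measurable]) simp
  also have "(\<lambda>(u, v). glue i v u) -` {x. last_boundary_visit n i x} \<inter> space (P \<Otimes>\<^sub>M P)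
      = {w. window_event i (n - i) (fst w) (snd w)}"
    unfolding space_PP by (auto simp: window_event_glue[OF assms] last_boundary_visit_def Bex_def)
  finally show ?thesis by (simp add: window_prob_def)
qed

lemma expectation_boundary_count:
  "(\<integral>x. real (boundary_count n x) \<partial>P) = (\<Sum>i\<le>n. window_prob i (n - i))"
proof -
  have [measurable]: "{x. last_boundary_visit n i x} \<in> sets P" for i
    using last_boundary_visit_measurable[of n i] unfolding pred_def space_P by simp
  have ind: "of_bool (last_boundary_visit n i x) = (indicator {x. last_boundary_visit n i x} x :: real)" for i x
    by (simp add: indicator_def)
  have "(\<integral>x. real (boundary_count n x) \<partial>P)
      = (\<Sum>i\<le>n. \<integral>x. indicator {x. last_boundary_visit n i x} x \<partial>P)"
    unfolding boundary_count_eq_sum ind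
    by (rule Bochner_Integration.integral_sum) (simp add: P.emeasure_eq_measure)
  then show ?thesis by (simp add: prob_last_boundary_visit space_P)
qed

lemma rate_le_expectation: "real n * rate \<le> (\<integral>x. real (boundary_count n x) \<partial>P)"
proof -
  have "0 \<le> rate" by (simp add: rate_def)
  then have "real n * rate \<le> (\<Sum>i\<le>n. rate)" by (simp add: mult_right_mono)
  also have "\<dots> \<le> (\<Sum>i\<le>n. window_prob i (n - i))" by (intro sum_mono rate_le_window_prob)
  finally show ?thesis by (simp add: expectation_boundary_count)
qed

lemma expectation_upper:
  assumes "0 < e"
  obtains n where "0 < n" "(\<integral>x. real (boundary_count n x) \<partial>P) / real n \<le> rate + e"
proof -
  have "\<forall>\<^sub>F k in sequentially. window_prob k k < rate + e / 2"
    using window_prob_tendsto by (rule order_tendstoD) (use assms in simp)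
  then obtain k where k: "window_prob k k < rate + e / 2" by (auto simp: eventually_sequentially)
  \<comment> \<open>The number \<open>2 * k\<close> bounds the count of times near \<open>0\<close>
    or \<open>n\<close>, each costing at most 1; the further 1 pays for having \<open>n + 1\<close>
    times instead of \<open>n\<close>.\<close>
  have "\<forall>\<^sub>F n in sequentially. (2 * real k + 1) / real n < e / 2"
    by (rule order_tendstoD(2)[OF lim_const_over_n]) (use assms in simp)
  then have "\<forall>\<^sub>F n in sequentially. (2 * real k + 1) / real n < e / 2 \<and> 0 < n"
    using eventually_gt_at_top[of 0] by eventually_elim simp
  then obtain n where n: "(2 * real k + 1) / real n < e / 2" "0 < n"
    by (auto simp: eventually_sequentially)
  let ?E = "{i. i \<le> n \<and> (i < k \<or> n - i < k)}"
  have "?E \<subseteq> {..<k} \<union> (\<lambda>i. n - i) ` {..<k}"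
    by (auto simp: image_iff) (metis diff_diff_cancel lessThan_iff)
  then have "card ?E \<le> card ({..<k} \<union> (\<lambda>i. n - i) ` {..<k})" by (intro card_mono) auto
  also have "\<dots> \<le> card {..<k} + card ((\<lambda>i. n - i) ` {..<k})" by (rule card_Un_le)
  also have "\<dots> \<le> 2 * k" using card_image_le[of "{..<k}" "\<lambda>i. n - i"] by simp
  finally have E: "real (card ?E) \<le> 2 * real k" by linarith
  have "window_prob i (n - i) \<le> of_bool (i \<in> ?E) + window_prob k k" if "i \<le> n" for i
  proof (cases "i \<in> ?E")
    case True
    have "0 \<le> window_prob k k" by (simp add: window_prob_def)
    then show ?thesis using True window_prob_le_1[of i "n - i"] by simp
  next
    case False
    then show ?thesis using window_prob_antimono[of k i k "n - i"] that by auto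
  qed
  then have "(\<Sum>i\<le>n. window_prob i (n - i)) \<le> (\<Sum>i\<le>n. of_bool (i \<in> ?E) + window_prob k k)"
    by (intro sum_mono) simp
  also have "\<dots> = real (card ?E) + real (n + 1) * window_prob k k"
  proof -
    have "{..n} \<inter> ?E = ?E" by auto
    then show ?thesis by (simp add: sum.distrib del: mem_Collect_eq)
  qed
  also have "\<dots> \<le> (2 * real k + 1) + real n * window_prob k k"
    using E window_prob_le_1[of k k] by (simp add: algebra_simps)
  finally have "(\<integral>x. real (boundary_count n x) \<partial>P) / real n
      \<le> ((2 * real k + 1) + real n * window_prob k k) / real n"
    unfolding expectation_boundary_count by (rule divide_right_mono) simp
  also have "\<dots> = (2 * real k + 1) / real n + window_prob k k"
    using n by (simp add: add_divide_distrib)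
  also have "\<dots> \<le> rate + e" using n(1) k by linarith
  finally show ?thesis using that n by blast
qed

section \<open>The limit for i.i.d. step sequences\<close>

lemma shift_measurable: "shift \<in> P \<rightarrow>\<^sub>M P"
  unfolding shift_def by (rule reindex_measurable)

sublocale subadditive_process P shift "\<lambda>n x. real (boundary_count n x)" 1
proof
  show "distr P P shift = P"
    using reindex_preserving[of Suc] by (simp add: shift_def[abs_def])
  show "real (boundary_count n x) \<le> 1 * (real n + 1)" for n x
    using of_nat_mono[OF boundary_count_le[of n x], where 'a = real] by simp
  show "real (boundary_count (m + n) x) \<le> real (boundary_count m x) + real (boundary_count n ((shift ^^ m) x))"
    for m n x
    using of_nat_mono[OF boundary_count_add[of m n x], where 'a = real] by simp
qed (auto intro: shift_measurable)

lemma coordinates_indep: "P.indep_vars (\<lambda>_. \<mu>) (\<lambda>i x. x i) UNIV"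
proof -
  have "distr P \<mu> (\<lambda>x. x i) = \<mu>" for i
    using PiM_component[of i] by simp
  moreover have "distr P P (\<lambda>x. x) = P" by (simp add: distr_id)
  ultimately show ?thesis
    by (subst P.indep_vars_iff_distr_eq_PiM) (auto simp: restrict_def)
qed

text \<open>Each block count is a function of the coordinates in its own block, and the blocks are
  disjoint.\<close>

lemma blocks_indep:
  "P.indep_vars (\<lambda>_. borel) (\<lambda>j x. real (boundary_count m ((shift ^^ (j * m)) x))) UNIV"
proof -
  define K where "K j = {j * m..<j * m + m}" for j
  \<comment> \<open>Only coordinates in \<open>K j\<close> are read; \<open>boundary_count m\<close>
    sees just the first \<open>m\<close> steps, so padding with 0 does not change it.\<close>
  define Y where "Y j y = real (boundary_count m (\<lambda>i. if i < m then y (j * m + i) else 0))"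
    for j and y :: "nat \<Rightarrow> int ^ 'd"
  have "disjoint_family K"
    unfolding disjoint_family_on_def
  proof (intro ballI impI)
    fix j j' :: nat assume "j \<noteq> j'"
    have "i div m = j" if "i \<in> K j" for i j
      using that by (intro div_nat_eqI) (auto simp: K_def algebra_simps)
    then show "K j \<inter> K j' = {}" using \<open>j \<noteq> j'\<close> by blast
  qed
  then have "P.indep_vars (\<lambda>j. Pi\<^sub>M (K j) (\<lambda>_. \<mu>)) (\<lambda>j x. restrict (\<lambda>i. x i) (K j)) UNIV"
    by (intro P.indep_vars_restrict[OF coordinates_indep]) auto
  moreover have "Y j \<in> borel_measurable (Pi\<^sub>M (K j) (\<lambda>_. \<mu>))" for j
    unfolding Y_def
  proof (rule measurable_compose[OF _ boundary_count_measurable], rule measurable_PiM_single')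
    fix i
    show "(\<lambda>y. if i < m then y (j * m + i) else 0) \<in> Pi\<^sub>M (K j) (\<lambda>_. \<mu>) \<rightarrow>\<^sub>M \<mu>"
    proof (cases "i < m")
      case True
      then have "j * m + i \<in> K j" by (simp add: K_def)
      then show ?thesis using True by (simp add: measurable_component_singleton)
    qed (simp add: space_mu)
  qed (simp add: space_mu)
  ultimately have "P.indep_vars (\<lambda>_. borel) (\<lambda>j x. Y j (restrict (\<lambda>i. x i) (K j))) UNIV"
    by (rule P.indep_vars_compose2)
  moreover have "Y j (restrict (\<lambda>i. x i) (K j)) = real (boundary_count m ((shift ^^ (j * m)) x))" for j x
    unfolding Y_def of_nat_eq_iff
    by (rule boundary_count_cong) (simp add: K_def shift_funpow add.commute)
  ultimately show ?thesis by simp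
qed

lemma AE_boundary_count_tendsto: "AE x in P. (\<lambda>n. real (boundary_count n x) / real n) \<longlonglongrightarrow> rate"
proof (rule AE_tendsto[OF rate_le_expectation])
  fix e :: real assume "0 < e"
  then obtain m where m: "0 < m" "(\<integral>x. real (boundary_count m x) \<partial>P) / real m \<le> rate + e / 2"
    using expectation_upper[of "e / 2"] by auto
  have "AE x in P. \<forall>\<^sub>F n in sequentially.
      real (boundary_count n x) / real n \<le> (\<integral>x. real (boundary_count m x) \<partial>P) / real m + e / 2"
    using AE_eventually_le_block_average[OF blocks_indep m(1), of "e / 2"] \<open>0 < e\<close> by simp
  then show "AE x in P. \<forall>\<^sub>F n in sequentially. real (boundary_count n x) / real n \<le> rate + e"
  proof eventually_elim
    case (elim x)
    then show ?case by eventually_elim (use m(2) in linarith)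
  qed
qed

end

subsection \<open>Random walks\<close>

text \<open>The event is rewritten with quantifiers over lattice points and times, both
  countable.\<close>

lemma escape_event_measurable:
  "{(s, t). \<not> neighbours 0 \<subseteq> range s \<union> range t \<and> 0 \<notin> {s m | m. 1 \<le> m}}
    \<in> sets (path_space \<Otimes>\<^sub>M (path_space :: (nat \<Rightarrow> int ^ 'd) measure))"
proof -
  let ?Q = "(path_space :: (nat \<Rightarrow> int ^ 'd) measure) \<Otimes>\<^sub>M (path_space :: (nat \<Rightarrow> int ^ 'd) measure)"
  have coord: "(\<lambda>s :: nat \<Rightarrow> int ^ 'd. s m) \<in> path_space \<rightarrow>\<^sub>M count_space UNIV" for m
    by (rule measurable_component_singleton) simp
  have [measurable]: "Measurable.pred ?Q (\<lambda>w. fst w m \<noteq> e)" for m e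
    by (rule measurable_compose[OF measurable_compose[OF measurable_fst coord]]) simp
  have [measurable]: "Measurable.pred ?Q (\<lambda>w. snd w m \<noteq> e)" for m e
    by (rule measurable_compose[OF measurable_compose[OF measurable_snd coord]]) simp
  have "Measurable.pred ?Q (\<lambda>w. (\<exists>e. e \<in> neighbours 0 \<and> (\<forall>m. fst w m \<noteq> e) \<and> (\<forall>m. snd w m \<noteq> e))
      \<and> (\<forall>m. 1 \<le> m \<longrightarrow> fst w m \<noteq> 0))"
    by measurable
  then have "{w. (\<exists>e. e \<in> neighbours 0 \<and> (\<forall>m. fst w m \<noteq> e) \<and> (\<forall>m. snd w m \<noteq> e))
      \<and> (\<forall>m. 1 \<le> m \<longrightarrow> fst w m \<noteq> 0)} \<in> sets ?Q"
    by (simp add: pred_def space_pair_measure space_PiM)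
  also have "{w. (\<exists>e. e \<in> neighbours 0 \<and> (\<forall>m. fst w m \<noteq> e) \<and> (\<forall>m. snd w m \<noteq> e))
      \<and> (\<forall>m. 1 \<le> m \<longrightarrow> fst w m \<noteq> 0)}
    = {(s, t). \<not> neighbours 0 \<subseteq> range s \<union> range t \<and> 0 \<notin> {s m | m. 1 \<le> m}}"
    by (auto simp: set_eq_iff)
  finally show ?thesis .
qed

context random_walk
begin

abbreviation "step_distr \<equiv> distr M (count_space UNIV) (X 1)"

lemma step_measurable: "1 \<le> i \<Longrightarrow> X i \<in> M \<rightarrow>\<^sub>M count_space UNIV"
  using indep_steps by (auto simp: indep_vars_def)

sublocale law: step_law step_distr
  by (intro step_law.intro step_law_axioms.intro prob_space_distr step_measurable) simp_all

lemma law_sets: "sets law.P = sets path_space"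
  by (intro sets_PiM_cong) simp_all

lemma steps_measurable: "(\<lambda>\<omega> i. X (Suc i) \<omega>) \<in> M \<rightarrow>\<^sub>M law.P"
  by (rule measurable_PiM_single') (auto intro: step_measurable simp: law.measurable_mu_iff)

lemma distr_steps: "distr M law.P (\<lambda>\<omega> i. X (Suc i) \<omega>) = law.P"
proof -
  have "indep_vars (\<lambda>_. count_space UNIV) (\<lambda>i. X (Suc i)) UNIV"
  proof -
    \<comment> \<open>Reindexing along \<open>Suc\<close> is expressed as grouping the steps into
      singletons.\<close>
    have "indep_vars (\<lambda>j. Pi\<^sub>M {Suc j} (\<lambda>_. count_space UNIV)) (\<lambda>j \<omega>. restrict (\<lambda>i. X i \<omega>) {Suc j}) UNIV"
      by (rule indep_vars_restrict[OF indep_steps]) (auto simp: disjoint_family_on_def)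
    then have "indep_vars (\<lambda>_. count_space UNIV) (\<lambda>j \<omega>. restrict (\<lambda>i. X i \<omega>) {Suc j} (Suc j)) UNIV"
      by (rule indep_vars_compose2[where Y = "\<lambda>j y. y (Suc j)"]) (rule measurable_component_singleton, simp)
    then show ?thesis by simp
  qed
  then have "distr M path_space (\<lambda>\<omega>. \<lambda>i\<in>UNIV. X (Suc i) \<omega>)
      = (\<Pi>\<^sub>M i\<in>UNIV. distr M (count_space UNIV) (X (Suc i)))"
    by (subst (asm) indep_vars_iff_distr_eq_PiM) (auto intro: step_measurable)
  also have "\<dots> = law.P" by (intro PiM_cong refl identical_steps) simp
  finally show ?thesis using law_sets by (simp add: restrict_def cong: distr_cong)
qed

lemma AE_num_inner_boundary:
  "AE \<omega> in M. (\<lambda>n. real (num_inner_boundary (walk X) n \<omega>) / real n) \<longlonglongrightarrow> law.rate"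
  unfolding num_inner_boundary_eq
  by (rule AE_distrD[OF steps_measurable]) (simp only: distr_steps law.AE_boundary_count_tendsto)

lemma paths_measurable:
  "partial_sum \<in> law.P \<rightarrow>\<^sub>M path_space" "(\<lambda>x j. - partial_sum x j) \<in> law.P \<rightarrow>\<^sub>M path_space"
proof -
  show "partial_sum \<in> law.P \<rightarrow>\<^sub>M path_space"
    by (rule measurable_PiM_single') auto
  show "(\<lambda>x j. - partial_sum x j) \<in> law.P \<rightarrow>\<^sub>M path_space"
    by (rule measurable_PiM_single')
      (auto intro: measurable_compose[OF law.partial_sum_measurable])
qed

text \<open>The event depends only on the joint law of the two walks, which by independence is a
  product. Both factors are images of \<open>law.P\<close>, under \<open>partial_sum\<close> and its
  negative, so the event pulls back to the intersection of all window events.\<close>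

lemma escape_probability:
  assumes "independent_dual_walk M (walk X) S'"
  shows "measure M {\<omega> \<in> space M. \<not> neighbours 0 \<subseteq> {walk X m \<omega> | m. True} \<union> {S' m \<omega> | m. True}
               \<and> 0 \<notin> {walk X m \<omega> | m. m \<ge> 1}} = law.rate"
proof -
  let ?S = "\<lambda>\<omega> m. walk X m \<omega>" and ?S' = "\<lambda>\<omega> m. S' m \<omega>"
  let ?neg = "\<lambda>x j. - partial_sum x j"
  define E where "E = {(s :: nat \<Rightarrow> int ^ 'd, t :: nat \<Rightarrow> int ^ 'd). \<not> neighbours 0 \<subseteq> range s \<union> range t \<and> 0 \<notin> {s m | m. 1 \<le> m}}"
  have [measurable]: "E \<in> sets (path_space \<Otimes>\<^sub>M path_space)"
    unfolding E_def by (rule escape_event_measurable)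
  have S: "?S = partial_sum \<circ> (\<lambda>\<omega> i. X (Suc i) \<omega>)"
    "(\<lambda>\<omega> m. - walk X m \<omega>) = ?neg \<circ> (\<lambda>\<omega> i. X (Suc i) \<omega>)"
    by (auto simp: fun_eq_iff walk_eq_partial_sum)
  have law_S: "distr M path_space ?S = distr law.P path_space partial_sum"
    "distr M path_space (\<lambda>\<omega> m. - walk X m \<omega>) = distr law.P path_space ?neg"
    unfolding S
    by (simp_all only: distr_distr[OF paths_measurable(1) steps_measurable, symmetric]
        distr_distr[OF paths_measurable(2) steps_measurable, symmetric] distr_steps)
  have ind: "?S \<in> M \<rightarrow>\<^sub>M path_space" "?S' \<in> M \<rightarrow>\<^sub>M path_space"
    "distr M path_space ?S \<Otimes>\<^sub>M distr M path_space ?S' = distr M (path_space \<Otimes>\<^sub>M path_space) (\<lambda>\<omega>. (?S \<omega>, ?S' \<omega>))"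
    using assms unfolding independent_dual_walk_def indep_var_distribution_eq by blast+
  have S': "distr M path_space ?S' = distr law.P path_space ?neg"
    using assms law_S(2) unfolding independent_dual_walk_def by simp
  have "prob_space (distr law.P path_space ?neg)"
    by (rule law.P.prob_space_distr) (rule paths_measurable)
  then have sf: "sigma_finite_measure (distr law.P path_space ?neg)"
    by (simp add: prob_space_imp_sigma_finite)
  have "measure M {\<omega> \<in> space M. \<not> neighbours 0 \<subseteq> {walk X m \<omega> | m. True} \<union> {S' m \<omega> | m. True}
               \<and> 0 \<notin> {walk X m \<omega> | m. m \<ge> 1}}
    = measure M ((\<lambda>\<omega>. (?S \<omega>, ?S' \<omega>)) -` E \<inter> space M)"
    by (rule arg_cong[where f = "measure M"]) (auto simp: E_def full_SetCompr_eq)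
  also have "\<dots> = measure (distr M (path_space \<Otimes>\<^sub>M path_space) (\<lambda>\<omega>. (?S \<omega>, ?S' \<omega>))) E"
    by (rule measure_distr[symmetric]) (use ind in auto)
  also have "\<dots> = measure (distr law.P path_space partial_sum \<Otimes>\<^sub>M distr law.P path_space ?neg) E"
    by (simp only: ind(3)[symmetric] law_S(1) S')
  also have "\<dots> = measure (distr (law.P \<Otimes>\<^sub>M law.P) (path_space \<Otimes>\<^sub>M path_space) (\<lambda>(u, v). (partial_sum u, ?neg v))) E"
    by (simp only: pair_measure_distr[OF paths_measurable sf])
  also have "\<dots> = measure (law.P \<Otimes>\<^sub>M law.P) ((\<lambda>(u, v). (partial_sum u, ?neg v)) -` E \<inter> space (law.P \<Otimes>\<^sub>M law.P))"
    using paths_measurable by (intro measure_distr) (auto intro: measurable_compose)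
  also have "(\<lambda>(u, v). (partial_sum u, ?neg v)) -` E \<inter> space (law.P \<Otimes>\<^sub>M law.P)
     = {w. \<forall>k. window_event k k (fst w) (snd w)}"
    unfolding law.space_PP all_window_event_iff E_def by auto
  finally show ?thesis unfolding law.rate_def .
qed

end

theorem theorem2p1:
  fixes M :: "'w measure"
    and X S S' :: "nat \<Rightarrow> 'w \<Rightarrow> int ^ 'd"
    and q :: real
  assumes "random_walk M X"
    and "S = walk X"
    and "independent_dual_walk M S S'"
    and "q = measure M {\<omega> \<in> space M.
               \<not> neighbours 0 \<subseteq> {S m \<omega> | m. True} \<union> {S' m \<omega> | m. True}
               \<and> 0 \<notin> {S m \<omega> | m. m \<ge> 1}}"
  shows "AE \<omega> in M. (\<lambda>n. real (num_inner_boundary S n \<omega>) / real n) \<longlonglongrightarrow> q"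
proof -
  interpret random_walk M X by fact
  show ?thesis
    using AE_num_inner_boundary escape_probability[of S'] assms(2-4) by simp
qed

end
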